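(* Let $X$ be a compact metrizable space, let $f:X\to X$ be an expansive homeomorphism, and let $d$ be a hyperbolic metric on $X$ for $f$, with associated constant $k>1$. Then, for each $f$-invariant Borel probability measure $\mu$ and each $q\in[0,1)$, $$D^+_\mu(q)\le\frac{2h(f)}{\log k},$$ where $D^+_\mu(q)$ is computed with respect to the metric $d$ and $h(f)$ is the topological entropy of $f$.
   Context: A homeomorphism $f$ of a metrizable space $X$ is expansive if, for a metric $\rho$ inducing the topology of $X$, there is $\delta>0$ such that for each pair of different points $x,y\in X$ there is $n\in\mathbb{Z}$ with $\rho(f^n(x),f^n(y))>\delta$. Hyperbolic metric: a metric $d$ compatible with the topology of $X$ such that there are numbers $k>1$ and $\varepsilon>0$ with $$\max\{d(f(x),f(y)),d(f^{-1}(x),f^{-1}(y))\}\ge\min\{k\,d(x,y),\varepsilon\}\quad\text{for all }x,y\in X,$$ and such that both $f$ and $f^{-1}$ are Lipschitz for $d$. (By a theorem of Fathi, every expansive homeomorphism of a compact metrizable space admits such a metric.) Upper generalized fractal dimension: for $q\in\mathbb{R}\setminus\{1\}$, $$D^+_\mu(q)=\limsup_{r\downarrow0}\frac{\log\int_{\operatorname{supp}(\mu)}\mu(B(x,r))^{q-1}\,d\mu(x)}{(q-1)\log r},$$ where $B(x,r)$ is the open $d$-ball of radius $r$ centered at $x$ and $\operatorname{supp}(\mu)$ is the topological support of $\mu$. *)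

theory Defs
  imports "HOL-Analysis.Analysis" "HOL-Probability.Probability"
begin

text \<open>Self-maps of \<open>topspace X\<close> are represented by total functions; only their values on
  \<open>topspace X\<close> matter.  Accordingly the inverse is taken relative to \<open>topspace X\<close>.\<close>

definition homeo_inv :: "'a topology \<Rightarrow> ('a \<Rightarrow> 'a) \<Rightarrow> 'a \<Rightarrow> 'a" where
  "homeo_inv X f = inv_into (topspace X) f"

definition int_iterate :: "'a topology \<Rightarrow> ('a \<Rightarrow> 'a) \<Rightarrow> int \<Rightarrow> 'a \<Rightarrow> 'a" where
  "int_iterate X f n = (if n \<ge> 0 then f ^^ nat n else homeo_inv X f ^^ nat (- n))"

definition expansive_homeomorphism :: "'a topology \<Rightarrow> ('a \<Rightarrow> 'a) \<Rightarrow> bool" where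
  "expansive_homeomorphism X f \<longleftrightarrow>
     homeomorphic_map X X f \<and>
     (\<exists>\<rho> :: 'a metric. mtopology_of \<rho> = X \<and>
        (\<exists>\<delta> > 0. \<forall>x \<in> topspace X. \<forall>y \<in> topspace X. x \<noteq> y \<longrightarrow>
           (\<exists>n :: int. mdist \<rho> (int_iterate X f n x) (int_iterate X f n y) > \<delta>)))"

definition hyperbolic_metric :: "'a topology \<Rightarrow> ('a \<Rightarrow> 'a) \<Rightarrow> 'a metric \<Rightarrow> real \<Rightarrow> bool" where
  "hyperbolic_metric X f d k \<longleftrightarrow>
     mtopology_of d = X \<and> k > 1 \<and>
     (\<exists>\<epsilon> > 0. \<forall>x \<in> topspace X. \<forall>y \<in> topspace X.
        max (mdist d (f x) (f y)) (mdist d (homeo_inv X f x) (homeo_inv X f y))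
          \<ge> min (k * mdist d x y) \<epsilon>) \<and>
     Lipschitz_continuous_map d d f \<and>
     Lipschitz_continuous_map d d (homeo_inv X f)"

subsection \<open>Topological entropy, via open covers\<close>

definition open_cover :: "'a topology \<Rightarrow> 'a set set \<Rightarrow> bool" where
  "open_cover X \<U> \<longleftrightarrow> (\<forall>A \<in> \<U>. openin X A) \<and> \<Union>\<U> = topspace X"

definition min_subcover_card :: "'a topology \<Rightarrow> 'a set set \<Rightarrow> nat" where
  "min_subcover_card X \<U> =
     (LEAST n. \<exists>\<V> \<subseteq> \<U>. finite \<V> \<and> \<Union>\<V> = topspace X \<and> card \<V> = n)"

text \<open>The common refinement of the pulled back covers \<open>f ^ (-i) \<U>\<close>, \<open>0 \<le> i < n\<close>.\<close>

definition iterated_join :: "'a topology \<Rightarrow> ('a \<Rightarrow> 'a) \<Rightarrow> 'a set set \<Rightarrow> nat \<Rightarrow> 'a set set" where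
  "iterated_join X f \<U> n =
     {{x \<in> topspace X. \<forall>i < n. (f ^^ i) x \<in> A i} | A. \<forall>i < n. A i \<in> \<U>}"

text \<open>The sequence of logarithms is subadditive in \<open>n\<close> (\<open>X\<close> compact, \<open>f\<close> continuous),
  so the upper limit is a limit.\<close>

definition cover_entropy :: "'a topology \<Rightarrow> ('a \<Rightarrow> 'a) \<Rightarrow> 'a set set \<Rightarrow> ereal" where
  "cover_entropy X f \<U> =
     limsup (\<lambda>n. ereal (ln (real (min_subcover_card X (iterated_join X f \<U> n))) / real n))"

definition topological_entropy :: "'a topology \<Rightarrow> ('a \<Rightarrow> 'a) \<Rightarrow> ereal" where
  "topological_entropy X f = (SUP \<U> \<in> {\<U>. open_cover X \<U>}. cover_entropy X f \<U>)"

subsection \<open>Invariant Borel probability measures and generalized fractal dimensions\<close>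

definition borel_probability :: "'a topology \<Rightarrow> 'a measure \<Rightarrow> bool" where
  "borel_probability X \<mu> \<longleftrightarrow>
     space \<mu> = topspace X \<and> sets \<mu> = sigma_sets (topspace X) {U. openin X U} \<and> prob_space \<mu>"

definition invariant_measure :: "('a \<Rightarrow> 'a) \<Rightarrow> 'a measure \<Rightarrow> bool" where
  "invariant_measure f \<mu> \<longleftrightarrow>
     f \<in> measurable \<mu> \<mu> \<and> (\<forall>A \<in> sets \<mu>. emeasure \<mu> (f -` A \<inter> space \<mu>) = emeasure \<mu> A)"

definition topological_support :: "'a topology \<Rightarrow> 'a measure \<Rightarrow> 'a set" where
  "topological_support X \<mu> =
     {x \<in> topspace X. \<forall>U. openin X U \<and> x \<in> U \<longrightarrow> emeasure \<mu> U > 0}"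

definition ln_ennreal :: "ennreal \<Rightarrow> ereal" where
  "ln_ennreal x =
     (if x = 0 then -\<infinity> else if x = \<infinity> then \<infinity> else ereal (ln (enn2real x)))"

text \<open>Meaningful for \<open>q \<noteq> 1\<close>.  Balls centred in the support have positive measure, so the
  power with a negative exponent is never taken at \<open>0\<close>.\<close>

definition upper_fractal_dim :: "'a metric \<Rightarrow> 'a measure \<Rightarrow> real \<Rightarrow> ereal" where
  "upper_fractal_dim d \<mu> q =
     Limsup (at_right 0) (\<lambda>r :: real.
       ln_ennreal (\<integral>\<^sup>+ x \<in> topological_support (mtopology_of d) \<mu>.
           ennreal (measure \<mu> (Metric_space.mball (mspace d) (mdist d) x r) powr (q - 1)) \<partial>\<mu>)
       / ereal ((q - 1) * ln r))"

end

theory Submission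
  imports Defs "HOL-Real_Asymp.Real_Asymp"
begin

text \<open>Let \<open>\<U>\<close> be a cover by balls of radius \<open>\<epsilon> / 2\<close>. If two points have orbits that stay
  \<open>\<epsilon>\<close>-close for all times in \<open>[-n, n]\<close>, then hyperbolicity, applied \<open>n\<close> times, puts the points at
  distance less than \<open>\<epsilon> / k ^ n\<close>. So the image under \<open>f ^ n\<close> of a minimal subcover of the join of
  length \<open>2 n + 1\<close> covers the space by about \<open>exp (2 n h)\<close> sets of that diameter, which bounds the
  upper box dimension by \<open>2 h / ln k\<close>. For \<open>0 \<le> q < 1\<close> the generalized dimension is at most the
  box dimension, because the integral of \<open>1 / \<mu> (B (x, r))\<close> is at most the number of sets in
  a cover of mesh less than \<open>r\<close>, and Young's inequality passes to the power \<open>1 - q\<close>.\<close>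

section \<open>Integrals of powers of ball measures, bounded by cover cardinalities\<close>

text \<open>If \<open>x\<close> lies in \<open>A\<close>, then \<open>B x\<close> contains
  \<open>A\<close>, so the negative power of \<open>prob (B x)\<close> is at most that of
  \<open>prob A\<close>. Young's inequality makes this linear in \<open>1 / prob A\<close>, and each
  \<open>indicator A x / prob A\<close> has integral at most 1.\<close>

lemma (in prob_space) nn_integral_measure_powr_le_card:
  fixes q :: real
  assumes fin: "finite \<A>" and sets: "\<A> \<subseteq> sets M" and cover: "space M \<subseteq> \<Union>\<A>"
    and B: "\<And>A x. A \<in> \<A> \<Longrightarrow> x \<in> A \<Longrightarrow> A \<subseteq> B x \<and> B x \<in> sets M"
    and q: "0 \<le> q" "q < 1"
  shows "(\<integral>\<^sup>+ x \<in> S. ennreal (prob (B x) powr (q - 1)) \<partial>M) \<le> ennreal (real (card \<A>) powr (1 - q))"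
proof -
  let ?N = "real (card \<A>)"
  have "\<A> \<noteq> {}"
    using cover not_empty by auto
  then have N: "?N > 0"
    using fin by (simp add: card_gt_0_iff)
  \<comment> \<open>Summing over all members of \<open>\<A>\<close>, instead of choosing one that
    contains \<open>x\<close>, gives an integrable majorant whose integral is computed
    termwise.\<close>
  define h where
    "h x = ?N powr (1 - q) * ((1 - q) / ?N * (\<Sum>A\<in>\<A>. indicator A x / prob A) + q)" for x
  \<comment> \<open>On a null member of the cover the quotient in \<open>h\<close> is 0 by the
    convention for division, so the pointwise bound is claimed only off these finitely many
    sets.\<close>
  have AE: "AE x in M. \<forall>A\<in>\<A>. x \<in> A \<longrightarrow> prob A \<noteq> 0"
  proof (rule AE_finite_allI[OF fin])
    fix A assume A: "A \<in> \<A>"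
    show "AE x in M. x \<in> A \<longrightarrow> prob A \<noteq> 0"
    proof (cases "prob A = 0")
      case True
      then have "AE x in M. x \<notin> A"
        using A sets by (intro AE_not_in) (auto simp: null_sets_def emeasure_eq_measure)
      then show ?thesis by eventually_elim simp
    qed auto
  qed
  have le: "prob (B x) powr (q - 1) \<le> h x"
    if x: "x \<in> space M" and nz: "\<forall>A\<in>\<A>. x \<in> A \<longrightarrow> prob A \<noteq> 0" for x
  proof -
    obtain A where A: "A \<in> \<A>" "x \<in> A"
      using x cover by auto
    have p: "prob A > 0"
      using nz A by (simp add: zero_less_measure_iff)
    have "prob A \<le> prob (B x)"
      using B[OF A] by (intro finite_measure_mono) auto
    then have "prob (B x) powr (q - 1) \<le> prob A powr (q - 1)"
      using p q by (intro powr_mono2') auto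
    \<comment> \<open>Dividing by \<open>?N\<close> first normalises the sum over the cover to have
      integral at most 1; the Young weights \<open>1 - q\<close> and \<open>q\<close> then add up to
      1 and only the prefactor remains.\<close>
    also have "\<dots> = ?N powr (1 - q) * ((1 / (?N * prob A)) powr (1 - q) * 1 powr q)"
      using p N by (simp add: powr_divide powr_mult powr_diff field_simps)
    also have "\<dots> \<le> ?N powr (1 - q) * ((1 - q) * (1 / (?N * prob A)) + q * 1)"
      using p N q by (intro mult_left_mono Youngs_inequality_0) auto
    also have "\<dots> = ?N powr (1 - q) * ((1 - q) / ?N * (indicator A x / prob A) + q)"
      using A by simp
    also have "\<dots> \<le> h x"
      unfolding h_def using A fin N q
      by (intro mult_left_mono add_right_mono member_le_sum divide_nonneg_nonneg) auto
    finally show ?thesis .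
  qed
  have h0: "h x \<ge> 0" for x
    unfolding h_def using N q
    by (intro mult_nonneg_nonneg add_nonneg_nonneg sum_nonneg divide_nonneg_nonneg) auto
  have inth: "integrable M h"
    unfolding h_def using sets
    by (auto intro!: Bochner_Integration.integrable_add integrable_mult_right
          Bochner_Integration.integrable_sum integrable_divide integrable_indicator
          simp: emeasure_eq_measure)
  have "(\<integral>\<^sup>+ x \<in> S. ennreal (prob (B x) powr (q - 1)) \<partial>M) \<le> (\<integral>\<^sup>+ x. ennreal (h x) \<partial>M)"
  proof (rule nn_integral_mono_AE)
    show "AE x in M. ennreal (prob (B x) powr (q - 1)) * indicator S x \<le> ennreal (h x)"
      using AE AE_space by eventually_elim (auto simp: indicator_def intro!: ennreal_leI le)
  qed
  also have "\<dots> = ennreal (integral\<^sup>L M h)"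
    using inth h0 by (simp add: nn_integral_eq_integral)
  also have "integral\<^sup>L M h = ?N powr (1 - q) * ((1 - q) / ?N * (\<Sum>A\<in>\<A>. prob A / prob A) + q)"
  proof -
    have "integrable M (\<lambda>x. indicator A x / prob A)" if "A \<in> \<A>" for A
      using that sets by (intro integrable_divide integrable_real_indicator)
         (auto simp: emeasure_eq_measure)
    moreover have "A \<inter> space M = A" if "A \<in> \<A>" for A
      using that sets sets.sets_into_space by blast
    ultimately show ?thesis
      unfolding h_def by (simp add: prob_space Bochner_Integration.integral_sum)
  qed
  \<comment> \<open>An inequality, because null members contribute \<open>0 / 0 = 0\<close>.\<close>
  also have "\<dots> \<le> ?N powr (1 - q) * ((1 - q) / ?N * (\<Sum>A\<in>\<A>. 1) + q)"
    using N q by (intro mult_left_mono add_right_mono sum_mono) auto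
  also have "\<dots> = ?N powr (1 - q)"
    using N by simp
  finally show ?thesis
    by (simp add: ennreal_leI)
qed

section \<open>Hyperbolicity and the size of sets in iterated joins\<close>

text \<open>From any index, one of the two neighbours carries a value at least \<open>k\<close>
  times larger. Starting at the centre \<open>n\<close>, such a walk can be continued for
  \<open>n\<close> steps before it can leave \<open>{0..2 * n}\<close>, and its final value is still
  below \<epsilon>.\<close>

lemma expanding_sequence_center:
  fixes b :: "nat \<Rightarrow> real"
  assumes "k > 0" and b: "\<And>i. i \<le> 2 * n \<Longrightarrow> b i < \<epsilon>"
    and step: "\<And>i. i + 2 \<le> 2 * n \<Longrightarrow> max (b (i + 2)) (b i) \<ge> min (k * b (Suc i)) \<epsilon>"
  shows "b n * k ^ n < \<epsilon>"
proof -
  have "\<exists>i. n \<le> i + j \<and> i \<le> n + j \<and> b n * k ^ j \<le> b i" if "j \<le> n" for j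
    using that
  proof (induction j)
    case 0
    then show ?case by auto
  next
    case (Suc j)
    then obtain i where i: "n \<le> i + j" "i \<le> n + j" "b n * k ^ j \<le> b i"
      by auto
    then obtain l where l: "i = Suc l"
      using Suc.prems by (cases i) auto
    \<comment> \<open>Both neighbours lie below \<epsilon>, so the minimum in \<open>step\<close>
      cannot be \<epsilon>.\<close>
    have "max (b (l + 2)) (b l) \<ge> k * b i"
      using step[of l] b[of l] b[of "l + 2"] i l Suc.prems by auto
    moreover have "b n * k ^ Suc j \<le> k * b i"
      using mult_left_mono[OF i(3), of k] \<open>k > 0\<close> by (simp add: mult_ac)
    ultimately have "b n * k ^ Suc j \<le> b (l + 2) \<or> b n * k ^ Suc j \<le> b l"
      by linarith
    then show ?case
    proof
      assume "b n * k ^ Suc j \<le> b (l + 2)"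
      then show ?thesis using i l by (intro exI[of _ "l + 2"]) auto
    next
      assume "b n * k ^ Suc j \<le> b l"
      then show ?thesis using i l by (intro exI[of _ l]) auto
    qed
  qed
  from this[of n] obtain i where "i \<le> 2 * n" "b n * k ^ n \<le> b i"
    by (auto simp: mult_2)
  then show ?thesis using b[of i] by simp
qed

lemma homeomorphic_map_funpow:
  assumes "homeomorphic_map X X f"
  shows "homeomorphic_map X X (f ^^ n)"
proof (induction n)
  case (Suc n)
  then show ?case
    unfolding funpow.simps using assms by (rule homeomorphic_map_compose)
qed (simp add: id_def[symmetric] del: id_apply)

lemma open_cover_iterated_join:
  assumes f: "homeomorphic_map X X f" and U: "open_cover X \<U>"
  shows "open_cover X (iterated_join X f \<U> n)"
proof -
  have "openin X {x \<in> topspace X. \<forall>i<n. (f ^^ i) x \<in> A i}" if "\<forall>i<n. A i \<in> \<U>" for A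
    using that
  proof (induction n)
    case (Suc n)
    have "openin X {x \<in> topspace X. (f ^^ n) x \<in> A n}"
      using homeomorphic_imp_continuous_map[OF homeomorphic_map_funpow[OF f]] U Suc.prems
      by (auto simp: open_cover_def intro!: openin_continuous_map_preimage)
    then have "openin X ({x \<in> topspace X. \<forall>i<n. (f ^^ i) x \<in> A i} \<inter> {x \<in> topspace X. (f ^^ n) x \<in> A n})"
      using Suc by (intro openin_Int) auto
    also have "{x \<in> topspace X. \<forall>i<n. (f ^^ i) x \<in> A i} \<inter> {x \<in> topspace X. (f ^^ n) x \<in> A n}
        = {x \<in> topspace X. \<forall>i<Suc n. (f ^^ i) x \<in> A i}"
      by (auto simp: less_Suc_eq)
    finally show ?case .
  qed simp
  moreover have "x \<in> \<Union> (iterated_join X f \<U> n)" if x: "x \<in> topspace X" for x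
  proof -
    have "\<exists>A\<in>\<U>. (f ^^ i) x \<in> A" for i
      using homeomorphic_imp_surjective_map[OF homeomorphic_map_funpow[OF f]] x U
      unfolding open_cover_def by blast
    then obtain A where "\<And>i. A i \<in> \<U> \<and> (f ^^ i) x \<in> A i"
      by metis
    then show ?thesis
      using x unfolding iterated_join_def by blast
  qed
  moreover have "\<Union> (iterated_join X f \<U> n) \<subseteq> topspace X"
    by (auto simp: iterated_join_def)
  ultimately show ?thesis
    unfolding open_cover_def by (auto simp: iterated_join_def)
qed

lemma obtain_min_subcover:
  assumes "compact_space X" "open_cover X \<U>"
  obtains \<V> where "\<V> \<subseteq> \<U>" "finite \<V>" "\<Union>\<V> = topspace X" "card \<V> = min_subcover_card X \<U>"
proof -
  have "\<exists>\<V> \<subseteq> \<U>. finite \<V> \<and> \<Union>\<V> = topspace X"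
    using assms unfolding compact_space open_cover_def by metis
  then have "\<exists>n. \<exists>\<V> \<subseteq> \<U>. finite \<V> \<and> \<Union>\<V> = topspace X \<and> card \<V> = n"
    by blast
  from LeastI_ex[OF this] show ?thesis
    using that unfolding min_subcover_card_def by blast
qed

text \<open>The join sees only forward times \<open>0\<close> to \<open>2 * n\<close>, so the window
  from \<open>-n\<close> to \<open>n\<close> is shifted by \<open>n\<close>. Its centre is time
  \<open>n\<close>, which is why the estimate concerns the images under
  \<open>f ^^ n\<close>.\<close>

lemma hyperbolic_metric_iterated_join_diameter:
  assumes f: "homeomorphic_map X X f"
    and k: "k > 0"
    and d: "\<And>x y. x \<in> topspace X \<Longrightarrow> y \<in> topspace X \<Longrightarrow>
        max (mdist d (f x) (f y)) (mdist d (homeo_inv X f x) (homeo_inv X f y)) \<ge> min (k * mdist d x y) \<epsilon>"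
    and U: "\<And>U x y. U \<in> \<U> \<Longrightarrow> x \<in> U \<Longrightarrow> y \<in> U \<Longrightarrow> mdist d x y < \<epsilon>"
    and V: "V \<in> iterated_join X f \<U> (2 * n + 1)" and x: "x \<in> V" and y: "y \<in> V"
  shows "mdist d ((f ^^ n) x) ((f ^^ n) y) * k ^ n < \<epsilon>"
proof -
  obtain A where A: "\<And>i. i < 2 * n + 1 \<Longrightarrow> A i \<in> \<U>"
    and VA: "V = {x \<in> topspace X. \<forall>i<2 * n + 1. (f ^^ i) x \<in> A i}"
    using V unfolding iterated_join_def by blast
  have top: "(f ^^ i) z \<in> topspace X" if "z \<in> V" for i z
    using homeomorphic_imp_surjective_map[OF homeomorphic_map_funpow[OF f]] that VA by blast
  have inv: "homeo_inv X f ((f ^^ Suc i) z) = (f ^^ i) z" if "z \<in> V" for i z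
    using homeomorphic_imp_injective_map[OF f] top[OF that]
    by (simp add: homeo_inv_def inv_into_f_f)
  show ?thesis
  proof (rule expanding_sequence_center[OF k])
    fix i assume "i \<le> 2 * n"
    then show "mdist d ((f ^^ i) x) ((f ^^ i) y) < \<epsilon>"
      using x y VA by (intro U[OF A[of i]]) auto
  next
    fix i
    show "max (mdist d ((f ^^ (i + 2)) x) ((f ^^ (i + 2)) y)) (mdist d ((f ^^ i) x) ((f ^^ i) y))
        \<ge> min (k * mdist d ((f ^^ Suc i) x) ((f ^^ Suc i) y)) \<epsilon>"
      \<comment> \<open>At time \<open>Suc i\<close>, applying \<open>f\<close> leads to time
        \<open>i + 2\<close> and the inverse leads back to time \<open>i\<close>.\<close>
      using d[OF top[OF x] top[OF y], of "Suc i" "Suc i"] unfolding inv[OF x] inv[OF y] by simp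
  qed
qed

text \<open>Both \<epsilon> and \<open>\<U>\<close> are chosen before \<open>n\<close>, so the
  entropy of a single cover controls all scales at once.\<close>

lemma hyperbolic_metric_small_covers:
  assumes X: "compact_space X" and f: "homeomorphic_map X X f" and d: "hyperbolic_metric X f d k"
  obtains \<epsilon> \<U> where "\<epsilon> > 0" "open_cover X \<U>"
    "\<And>n. \<exists>\<A>. finite \<A> \<and> open_cover X \<A> \<and>
       card \<A> \<le> min_subcover_card X (iterated_join X f \<U> (2 * n + 1)) \<and>
       (\<forall>A\<in>\<A>. \<forall>x\<in>A. \<forall>y\<in>A. mdist d x y * k ^ n < \<epsilon>)"
proof -
  interpret Metric_space "mspace d" "mdist d"
    by (rule Metric_space_mspace_mdist)
  obtain \<epsilon> where e: "\<epsilon> > 0" and k: "k > 1" and dX: "mtopology_of d = X"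
    and exp: "\<And>x y. x \<in> topspace X \<Longrightarrow> y \<in> topspace X \<Longrightarrow>
        max (mdist d (f x) (f y)) (mdist d (homeo_inv X f x) (homeo_inv X f y)) \<ge> min (k * mdist d x y) \<epsilon>"
    using d unfolding hyperbolic_metric_def by blast
  have top: "topspace X = mspace d"
    using dX by auto
  \<comment> \<open>Radius \<open>\<epsilon> / 2\<close> keeps two points of one member closer than
    \<epsilon>, the threshold in the hyperbolicity condition.\<close>
  define \<U> where "\<U> = (\<lambda>x. mball x (\<epsilon> / 2)) ` topspace X"
  have cover: "open_cover X \<U>"
    using e dX unfolding open_cover_def \<U>_def by (auto simp: top mtopology_of_def)
  have small: "mdist d x y < \<epsilon>" if U: "U \<in> \<U>" and "x \<in> U" "y \<in> U" for U x y
  proof -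
    obtain z where "z \<in> mspace d" "U = mball z (\<epsilon> / 2)"
      using U unfolding \<U>_def top by blast
    then show ?thesis
      using that(2,3) triangle[of x z y] commute[of x z] by auto
  qed
  show ?thesis
  proof (rule that[OF e cover])
    fix n
    obtain \<V> where V: "\<V> \<subseteq> iterated_join X f \<U> (2 * n + 1)" "finite \<V>" "\<Union>\<V> = topspace X"
      "card \<V> = min_subcover_card X (iterated_join X f \<U> (2 * n + 1))"
      using obtain_min_subcover[OF X open_cover_iterated_join[OF f cover]] .
    define \<A> where "\<A> = (\<lambda>V. (f ^^ n) ` V) ` \<V>"
    have hom: "homeomorphic_map X X (f ^^ n)"
      by (rule homeomorphic_map_funpow[OF f])
    have "openin X V" if "V \<in> \<V>" for V
      using open_cover_iterated_join[OF f cover] V(1) that unfolding open_cover_def by blast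
    then have "openin X A" if "A \<in> \<A>" for A
      using that homeomorphic_imp_open_map[OF hom] unfolding \<A>_def open_map_def by blast
    moreover have "\<Union>\<A> = topspace X"
      using homeomorphic_imp_surjective_map[OF hom] V(3) unfolding \<A>_def by (metis image_Union)
    moreover have "card \<A> \<le> card \<V>"
      unfolding \<A>_def using V(2) by (rule card_image_le)
    moreover have "mdist d x y * k ^ n < \<epsilon>" if "A \<in> \<A>" "x \<in> A" "y \<in> A" for A x y
      using that V(1) k hyperbolic_metric_iterated_join_diameter[OF f _ exp small]
      unfolding \<A>_def by fastforce
    ultimately show "\<exists>\<A>. finite \<A> \<and> open_cover X \<A> \<and>
       card \<A> \<le> min_subcover_card X (iterated_join X f \<U> (2 * n + 1)) \<and>
       (\<forall>A\<in>\<A>. \<forall>x\<in>A. \<forall>y\<in>A. mdist d x y * k ^ n < \<epsilon>)"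
      using V(2,4) unfolding open_cover_def by (intro exI[of _ \<A>]) (auto simp: \<A>_def)
  qed
qed

section \<open>From cover cardinalities to the dimension estimate\<close>

lemma ln_ennreal_le:
  assumes "x \<le> ennreal a" "a > 0"
  shows "ln_ennreal x \<le> ereal (ln a)"
proof (cases "x = 0")
  case False
  have fin: "x < \<infinity>"
    using assms(1) by (auto simp: le_less_trans)
  then have "enn2real x > 0" "enn2real x \<le> a"
    using False assms by (auto simp: enn2real_positive_iff enn2real_leI zero_less_iff_neq_zero)
  then show ?thesis
    using False fin by (simp add: ln_ennreal_def)
qed (simp add: ln_ennreal_def)

theorem theorem1p5:
  fixes X :: "'a topology" and f :: "'a \<Rightarrow> 'a" and d :: "'a metric"
    and k q :: real and \<mu> :: "'a measure"
  assumes "compact_space X" and "metrizable_space X"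
    and "expansive_homeomorphism X f"
    and "hyperbolic_metric X f d k"
    and "borel_probability X \<mu>" and "invariant_measure f \<mu>"
    and "0 \<le> q" and "q < 1"
  shows "upper_fractal_dim d \<mu> q \<le> 2 * topological_entropy X f / ereal (ln k)"
proof -
  have f: "homeomorphic_map X X f" and k: "k > 1" and dX: "mtopology_of d = X"
    using assms(3,4) by (auto simp: expansive_homeomorphism_def hyperbolic_metric_def)
  have lnk: "ln k > 0"
    using k by simp
  have sp: "space \<mu> = mspace d" and opens: "\<And>U. openin X U \<Longrightarrow> U \<in> sets \<mu>"
    using assms(5) dX unfolding borel_probability_def by auto
  interpret prob_space \<mu>
    using assms(5) by (simp add: borel_probability_def)
  interpret d: Metric_space "mspace d" "mdist d"
    by (rule Metric_space_mspace_mdist)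
  obtain \<epsilon> \<U> where e: "\<epsilon> > 0" and U: "open_cover X \<U>"
    and covers: "\<And>n. \<exists>\<A>. finite \<A> \<and> open_cover X \<A> \<and>
       card \<A> \<le> min_subcover_card X (iterated_join X f \<U> (2 * n + 1)) \<and>
       (\<forall>A\<in>\<A>. \<forall>x\<in>A. \<forall>y\<in>A. mdist d x y * k ^ n < \<epsilon>)"
    using hyperbolic_metric_small_covers[OF assms(1) f assms(4)] by metis
  let ?N = "\<lambda>m. min_subcover_card X (iterated_join X f \<U> m)"
  let ?I = "\<lambda>r. \<integral>\<^sup>+ x \<in> topological_support X \<mu>. ennreal (prob (d.mball x r) powr (q - 1)) \<partial>\<mu>"
  \<comment> \<open>At such a scale each cover member lies in the ball of radius \<open>r\<close>
    about any of its points, as the integral bound requires.\<close>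
  have bound: "ln_ennreal (?I r) \<le> ereal ((1 - q) * ln (real (?N (2 * n + 1))))"
    if "\<epsilon> \<le> r * k ^ n" for r n
  proof -
    obtain \<A> where A: "finite \<A>" "open_cover X \<A>" "card \<A> \<le> ?N (2 * n + 1)"
      and small: "\<And>A x y. A \<in> \<A> \<Longrightarrow> x \<in> A \<Longrightarrow> y \<in> A \<Longrightarrow> mdist d x y * k ^ n < \<epsilon>"
      using covers[of n] by blast
    have un: "\<Union>\<A> = mspace d" and sub: "\<A> \<subseteq> sets \<mu>"
      using A(2) opens dX unfolding open_cover_def by auto
    have "A \<subseteq> d.mball x r" if "A \<in> \<A>" "x \<in> A" for A x
    proof
      fix y assume y: "y \<in> A"
      have "mdist d x y * k ^ n < r * k ^ n"
        using small[OF that y] \<open>\<epsilon> \<le> r * k ^ n\<close> by simp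
      then have "mdist d x y < r"
        using k by simp
      then show "y \<in> d.mball x r"
        using that y un by auto
    qed
    moreover have "d.mball x r \<in> sets \<mu>" for x
      using dX by (intro opens) (auto simp: mtopology_of_def)
    ultimately have le: "?I r \<le> ennreal (real (card \<A>) powr (1 - q))"
      using A(1) sub un sp assms(7,8) by (intro nn_integral_measure_powr_le_card) auto
    have "\<A> \<noteq> {}"
      using un sp not_empty by auto
    then have c: "card \<A> > 0"
      using A(1) by (simp add: card_gt_0_iff)
    then have "ln_ennreal (?I r) \<le> ereal (ln (real (card \<A>) powr (1 - q)))"
      by (intro ln_ennreal_le[OF le]) simp
    also have "\<dots> \<le> ereal ((1 - q) * ln (real (?N (2 * n + 1))))"
      using A(3) c assms(8) by (simp add: ln_powr)
    finally show ?thesis .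
  qed
  have main: "upper_fractal_dim d \<mu> q \<le> ereal (2 * c / ln k)" if c: "topological_entropy X f < ereal c" for c
  proof -
    have "cover_entropy X f \<U> < ereal c"
      using U c unfolding topological_entropy_def by (meson SUP_lessD mem_Collect_eq)
    then have "\<forall>\<^sub>F m in sequentially. ereal (ln (real (?N m)) / real m) < ereal c"
      unfolding cover_entropy_def by (rule Limsup_lessD)
    then obtain M where M: "\<And>m. m \<ge> M \<Longrightarrow> ln (real (?N m)) / real m < c"
      by (auto simp: eventually_sequentially)
    \<comment> \<open>Logarithms of natural numbers are nonnegative, with \<open>ln 0 = 0\<close>,
      and for \<open>M = 0\<close> the quotient is 0. Positivity of \<open>c\<close> gives
      monotonicity when \<open>2 * n + 1\<close> is estimated below.\<close>
    have c0: "c > 0"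
    proof -
      have "0 \<le> ln (real (?N M)) / real M"
        by (cases "?N M = 0") auto
      then show ?thesis
        using M[of M] by simp
    qed
    \<comment> \<open>Rounding up gives \<open>n \<le> ln (\<epsilon> / r) / ln k + 1\<close>, hence
      the constant 3 as a bound for the excess in \<open>2 * n + 1\<close>. The factor
      \<open>1 - q\<close> has cancelled against \<open>(q - 1) * ln r\<close>.\<close>
    let ?g = "\<lambda>r. c * (2 * (ln (\<epsilon> / r) / ln k) + 3) / (- ln r)"
    have "\<forall>\<^sub>F r in at_right 0. ln (\<epsilon> / r) / ln k \<ge> real M"
      using lnk e by real_asymp
    moreover have "\<forall>\<^sub>F r in at_right (0::real). r < 1 \<and> r > 0"
      by (auto simp: eventually_at_right_less intro!: eventually_conj eventually_at_rightI[of 0 1])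
    ultimately have "\<forall>\<^sub>F r in at_right 0. ln_ennreal (?I r) / ereal ((q - 1) * ln r) \<le> ereal (?g r)"
    proof eventually_elim
      case (elim r)
      \<comment> \<open>The least \<open>n\<close> with \<open>\<epsilon> \<le> r * k ^ n\<close>;
        the quotient is at least \<open>M\<close>, so \<open>nat\<close> truncates nothing and
        \<open>2 * n + 1\<close> is in the range of the entropy bound.\<close>
      define n where "n = nat \<lceil>ln (\<epsilon> / r) / ln k\<rceil>"
      have n: "ln (\<epsilon> / r) / ln k \<le> real n" "real n \<le> ln (\<epsilon> / r) / ln k + 1"
        using elim unfolding n_def by linarith+
      have "ln (\<epsilon> / r) \<le> ln (k ^ n)"
        using n(1) lnk k by (simp add: ln_realpow field_simps)
      then have "\<epsilon> / r \<le> k ^ n"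
        using e elim k by (subst (asm) ln_le_cancel_iff) auto
      then have "\<epsilon> \<le> r * k ^ n"
        using elim by (simp add: field_simps)
      note bound[OF this]
      also have "(1 - q) * ln (real (?N (2 * n + 1))) \<le> (1 - q) * (c * (2 * (ln (\<epsilon> / r) / ln k) + 3))"
      proof (intro mult_left_mono)
        have "M \<le> 2 * n + 1"
          using elim n(1) by linarith
        from M[OF this] have "ln (real (?N (2 * n + 1))) \<le> c * real (2 * n + 1)"
          by (simp add: field_simps)
        also have "\<dots> \<le> c * (2 * (ln (\<epsilon> / r) / ln k) + 3)"
          using n(2) c0 by (intro mult_left_mono) auto
        finally show "ln (real (?N (2 * n + 1))) \<le> c * (2 * (ln (\<epsilon> / r) / ln k) + 3)" .
      qed (use assms(8) in auto)
      finally have "ln_ennreal (?I r) \<le> ereal ((1 - q) * (c * (2 * (ln (\<epsilon> / r) / ln k) + 3)))"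
        by simp
      moreover have pos: "(q - 1) * ln r > 0"
        using elim assms(8) by (intro mult_neg_neg) auto
      ultimately have "ln_ennreal (?I r) / ereal ((q - 1) * ln r)
          \<le> ereal ((1 - q) * (c * (2 * (ln (\<epsilon> / r) / ln k) + 3))) / ereal ((q - 1) * ln r)"
        by (intro ereal_divide_right_mono) auto
      also have "\<dots> = ereal ((1 - q) * (c * (2 * (ln (\<epsilon> / r) / ln k) + 3)) / ((q - 1) * ln r))"
        using pos by (subst ereal_divide) auto
      also have "(1 - q) * (c * (2 * (ln (\<epsilon> / r) / ln k) + 3)) / ((q - 1) * ln r) = ?g r"
        using mult_divide_mult_cancel_left[of "1 - q" _ "- ln r"] assms(8)
        by (metis diff_gt_0_iff_gt minus_diff_eq minus_mult_commute order_less_irrefl)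
      finally show ?case .
    qed
    then have "upper_fractal_dim d \<mu> q \<le> Limsup (at_right 0) (\<lambda>r. ereal (?g r))"
      unfolding upper_fractal_dim_def dX by (rule Limsup_mono)
    also have "(?g \<longlongrightarrow> 2 * c / ln k) (at_right 0)"
      using lnk e c0 by (real_asymp simp: field_simps)
    then have "Limsup (at_right 0) (\<lambda>r. ereal (?g r)) = ereal (2 * c / ln k)"
      by (intro lim_imp_Limsup) auto
    finally show ?thesis .
  qed
  show ?thesis
  \<comment> \<open>Letting \<open>c\<close> decrease to the entropy gives the claim; for infinite
    entropy no \<open>z\<close> lies above the right-hand side.\<close>
  proof (rule dense_ge)
    fix z assume z: "2 * topological_entropy X f / ereal (ln k) < z"
    show "upper_fractal_dim d \<mu> q \<le> z"
    proof (cases z)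
      case (real r)
      then have "topological_entropy X f < ereal (r * ln k / 2)"
        using z lnk by (cases "topological_entropy X f") (auto simp: field_simps)
      from main[OF this] show ?thesis
        using lnk real by simp
    qed (use z in auto)
  qed
qed

end
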